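(* Let $X$ be a linearly ordered topological pospace and let $L$ be a subspace of $X$ such that $L$ is a compact topological pospace and every maximal $X\setminus L$-chain in $X$ is a compact topological pospace. Then $X$ is an $H$-closed topological pospace.
   Context: All topological spaces are Hausdorff. A topological pospace is a topological space $X$ equipped with a continuous (closed) partial order $\leqslant$, i.e. one whose graph is closed in $X\times X$; it is linearly ordered if $\leqslant$ is a linear order. A topological pospace $X$ is $H$-closed if $X$ is a closed subspace of every Hausdorff topological pospace in which it is contained (as a subspace with the induced order). For $x\in X$, ${\uparrow}x=\{y\in X\mid x\leqslant y\}$ and ${\downarrow}x=\{y\in X\mid y\leqslant x\}$. For a subset $A$ of a linearly ordered set $X$, a subset $S\subseteq A$ is called an $A$-chain in $X$ if ${\uparrow}x\cap{\downarrow}y\subseteq A$ for all $x,y\in S$ with $x\leqslant y$; a maximal $A$-chain is an $A$-chain properly contained in no other $A$-chain. Subsets of $X$ are regarded as pospaces with the subspace topology and the induced order. *)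

theory Defs
  imports "HOL-Analysis.Analysis"
begin

(* A pospace is a topology X together with an order relation r whose field is
   topspace X; r, being a set of pairs, is itself the graph of the order. *)
definition pospace :: "'a topology \<Rightarrow> 'a rel \<Rightarrow> bool" where
  "pospace X r \<longleftrightarrow>
     Hausdorff_space X \<and> partial_order_on (topspace X) r \<and> closedin (prod_topology X X) r"

definition linearly_ordered_pospace :: "'a topology \<Rightarrow> 'a rel \<Rightarrow> bool" where
  "linearly_ordered_pospace X r \<longleftrightarrow> pospace X r \<and> linear_order_on (topspace X) r"

definition compact_pospace :: "'a topology \<Rightarrow> 'a rel \<Rightarrow> bool" where
  "compact_pospace X r \<longleftrightarrow> pospace X r \<and> compact_space X"

definition pospace_embedding ::
    "'a topology \<Rightarrow> 'a rel \<Rightarrow> 'b topology \<Rightarrow> 'b rel \<Rightarrow> ('a \<Rightarrow> 'b) \<Rightarrow> bool" where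
  "pospace_embedding X r Y s e \<longleftrightarrow>
     embedding_map X Y e \<and>
     (\<forall>x \<in> topspace X. \<forall>y \<in> topspace X. (x, y) \<in> r \<longleftrightarrow> (e x, e y) \<in> s)"

(* "X is contained in Y as a subspace with the induced order" is expressed by an
   embedding. HOL cannot quantify over types inside a formula, so the type of the
   points of Y is a parameter; leaving it a free type variable in the conclusion of a
   theorem quantifies over all Y. *)
definition H_closed_pospace :: "'b itself \<Rightarrow> 'a topology \<Rightarrow> 'a rel \<Rightarrow> bool" where
  "H_closed_pospace (T :: 'b itself) X r \<longleftrightarrow>
     pospace X r \<and>
     (\<forall>(Y :: 'b topology) s e.
        pospace Y s \<and> pospace_embedding X r Y s e \<longrightarrow> closedin Y (e ` topspace X))"

definition subset_chain :: "'a rel \<Rightarrow> 'a set \<Rightarrow> 'a set \<Rightarrow> bool" where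
  "subset_chain r A S \<longleftrightarrow>
     S \<subseteq> A \<and> (\<forall>x \<in> S. \<forall>y \<in> S. (x, y) \<in> r \<longrightarrow> above r x \<inter> under r y \<subseteq> A)"

definition maximal_subset_chain :: "'a rel \<Rightarrow> 'a set \<Rightarrow> 'a set \<Rightarrow> bool" where
  "maximal_subset_chain r A S \<longleftrightarrow>
     subset_chain r A S \<and> \<not> (\<exists>S'. subset_chain r A S' \<and> S \<subset> S')"

end

theory Submission
  imports Defs
begin

text \<open>
  Let \<open>e\<close> embed \<open>X\<close> in a pospace \<open>Y\<close>, and suppose that the closure of the image contains a point
  \<open>y\<close> outside the image. The points of \<open>Y\<close> comparable to a fixed point form a closed set, so \<open>y\<close> is
  comparable to every point of \<open>e ` X\<close>; hence \<open>y\<close> cuts \<open>L\<close> into a part \<open>A\<close> below and a part \<open>B\<close>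
  above it. Both parts are compact, as each is carved out of the compact image of \<open>L\<close> by a closed
  condition. The points of \<open>X\<close> that lie neither below a point of \<open>A\<close> nor above a point of \<open>B\<close> fill
  the gap \<open>G\<close> of \<open>L\<close> at this cut, and a nonempty gap is a maximal chain in the complement of \<open>L\<close>
  (\<open>gap_is_maximal_subset_chain\<close>), so \<open>G\<close> is compact.

  Thus \<open>e ` X\<close> is covered by three sets: the down-set of \<open>e ` A\<close>, the up-set of \<open>e ` B\<close>, and
  \<open>e ` G\<close>. The first two are closed in \<open>Y\<close> because a compact set generates a closed up-set
  (\<open>closedin_upset_of_compact\<close>), the third because \<open>Y\<close> is Hausdorff. So \<open>y\<close> lies in one of them.
  It cannot lie in \<open>e ` G\<close>; and if \<open>y\<close> were below a point of \<open>e ` A\<close>, which is itself below \<open>y\<close>,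
  antisymmetry would place \<open>y\<close> in \<open>e ` L\<close>. The same holds for \<open>B\<close>.
\<close>

text \<open>Statements about up-sets transfer to down-sets by passing to the opposite order.\<close>

lemma pospace_converse:
  assumes "pospace Y s"
  shows "pospace Y (s\<inverse>)"
proof -
  have "s\<inverse> = {z \<in> topspace (prod_topology Y Y). (\<lambda>(x, y). (y, x)) z \<in> s}"
    using assms closedin_subset unfolding pospace_def by fastforce
  moreover have "continuous_map (prod_topology Y Y) (prod_topology Y Y) (\<lambda>(x, y). (y, x))"
    by (simp add: case_prod_unfold continuous_map_pairwise comp_def
        continuous_map_fst continuous_map_snd)
  moreover have "closedin (prod_topology Y Y) s"
    using assms by (simp add: pospace_def)
  ultimately have "closedin (prod_topology Y Y) (s\<inverse>)"
    using closedin_continuous_map_preimage by fastforce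
  then show ?thesis
    using assms by (simp add: pospace_def)
qed

text \<open>
  The up-set of \<open>K\<close> is the image of the closed set \<open>s \<inter> (K \<times> Y)\<close> under the projection \<open>K \<times> Y \<rightarrow> Y\<close>,
  which is a closed map when \<open>K\<close> is compact.
\<close>

lemma closedin_upset_of_compact:
  assumes "pospace Y s" and "compactin Y K"
  shows "closedin Y (s `` K)"
proof -
  have sub: "s \<subseteq> topspace Y \<times> topspace Y"
    using assms(1) closedin_subset unfolding pospace_def by fastforce
  have "closedin (prod_topology (subtopology Y K) Y) (s \<inter> K \<times> topspace Y)"
    using assms(1) unfolding pospace_def prod_topology_subtopology(1) closedin_subtopology by blast
  moreover have "closed_map (prod_topology (subtopology Y K) Y) Y snd"
    using assms(2) by (simp add: closed_map_snd compactin_subspace)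
  ultimately have "closedin Y (snd ` (s \<inter> K \<times> topspace Y))"
    by (simp add: closed_map_def)
  moreover have "snd ` (s \<inter> K \<times> topspace Y) = s `` K"
    using sub by force
  ultimately show ?thesis
    by simp
qed

lemma closedin_downset_of_compact:
  assumes "pospace Y s" and "compactin Y K"
  shows "closedin Y (s\<inverse> `` K)"
  using assms pospace_converse closedin_upset_of_compact by blast

lemma linear_order_on_comparable:
  assumes "linear_order_on T r" and "x \<in> T" "z \<in> T"
  shows "(x, z) \<in> r \<or> (z, x) \<in> r"
  using assms by (cases "x = z") (auto simp: order_on_defs refl_on_def total_on_def)

text \<open>
  Convexity of the gap keeps it inside the complement of \<open>L\<close>. It cannot be enlarged: by linearity,
  a point outside the gap is separated from every point of the gap by an element of \<open>A\<close> or of \<open>B\<close>.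
\<close>

lemma gap_is_maximal_subset_chain:
  assumes lin: "linear_order_on T r" and rT: "r \<subseteq> T \<times> T" and LT: "A \<union> B \<subseteq> T"
    and ne: "T - r\<inverse> `` A - r `` B \<noteq> {}"
  shows "maximal_subset_chain r (T - (A \<union> B)) (T - r\<inverse> `` A - r `` B)"
    (is "maximal_subset_chain r (T - ?L) ?G")
proof -
  have refl: "(x, x) \<in> r" if "x \<in> T" for x
    using lin that by (simp add: order_on_defs refl_on_def)
  note comparable = linear_order_on_comparable[OF lin]
  have "?G \<subseteq> T - ?L"
    using refl LT by blast
  moreover have "above r x \<inter> under r z \<subseteq> T - ?L" if "x \<in> ?G" "z \<in> ?G" for x z
    using that rT unfolding above_def under_def by blast
  ultimately have chain: "subset_chain r (T - ?L) ?G"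
    unfolding subset_chain_def by blast
  have "\<not> subset_chain r (T - ?L) S" if GS: "?G \<subset> S" for S
  proof
    assume S: "subset_chain r (T - ?L) S"
    obtain g where g: "g \<in> ?G" "g \<in> S"
      using ne GS by blast
    obtain z where z: "z \<in> S" "z \<notin> ?G"
      using GS by blast
    have "z \<in> T"
      using S z unfolding subset_chain_def by blast
    then consider a where "a \<in> A" "(z, a) \<in> r" | b where "b \<in> B" "(b, z) \<in> r"
      using z by blast
    then show False
    proof cases
      case 1
      then have ag: "(a, g) \<in> r"
        using g comparable[of a g] LT by blast
      have "(z, g) \<in> r"
        using 1(2) ag lin unfolding order_on_defs by (blast dest: transD)
      then have "a \<in> T - ?L"
        using S z(1) g(2) 1(2) ag \<open>(z, g) \<in> r\<close>
        unfolding subset_chain_def above_def under_def by fast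
      then show False
        using 1 by blast
    next
      case 2
      then have gb: "(g, b) \<in> r"
        using g comparable[of b g] LT by blast
      have "(g, z) \<in> r"
        using 2(2) gb lin unfolding order_on_defs by (blast dest: transD)
      then have "b \<in> T - ?L"
        using S z(1) g(2) 2(2) gb \<open>(g, z) \<in> r\<close>
        unfolding subset_chain_def above_def under_def by fast
      then show False
        using 2 by blast
    qed
  qed
  with chain show ?thesis
    unfolding maximal_subset_chain_def by blast
qed

text \<open>
  The comparability set of \<open>x\<close> is the union of the up-set and the down-set of the compact set \<open>{x}\<close>,
  so it is closed and passes from \<open>C\<close> to its closure.
\<close>

lemma comparable_to_closure_of_chain:
  assumes Y: "pospace Y s" and C: "C \<subseteq> topspace Y"
    and chain: "\<And>x z. x \<in> C \<Longrightarrow> z \<in> C \<Longrightarrow> (x, z) \<in> s \<or> (z, x) \<in> s"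
    and "y \<in> Y closure_of C" "x \<in> C"
  shows "(x, y) \<in> s \<or> (y, x) \<in> s"
proof -
  have "compactin Y {x}"
    using C \<open>x \<in> C\<close> by auto
  then have "closedin Y (s `` {x} \<union> s\<inverse> `` {x})"
    using Y by (intro closedin_Un closedin_upset_of_compact closedin_downset_of_compact)
  moreover have "C \<subseteq> s `` {x} \<union> s\<inverse> `` {x}"
    using chain \<open>x \<in> C\<close> by blast
  ultimately show ?thesis
    using closure_of_minimal \<open>y \<in> Y closure_of C\<close> by blast
qed

theorem corollary4p5:
  fixes X :: "'a topology" and r :: "'a rel" and L :: "'a set"
  assumes "linearly_ordered_pospace X r"
    and "L \<subseteq> topspace X"
    and "compact_pospace (subtopology X L) (Restr r L)"
    and "\<And>S. maximal_subset_chain r (topspace X - L) S \<Longrightarrow>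
           compact_pospace (subtopology X S) (Restr r S)"
  shows "H_closed_pospace TYPE('b) X r"
  unfolding H_closed_pospace_def
proof (intro conjI allI impI)
  show X: "pospace X r"
    using assms(1) by (simp add: linearly_ordered_pospace_def)
  have lin: "linear_order_on (topspace X) r"
    using assms(1) by (simp add: linearly_ordered_pospace_def)
  have rX: "r \<subseteq> topspace X \<times> topspace X"
    using X closedin_subset unfolding pospace_def by fastforce
  fix Y :: "'b topology" and s e
  assume "pospace Y s \<and> pospace_embedding X r Y s e"
  then have Y: "pospace Y s" and emb: "embedding_map X Y e"
    and mono: "\<And>x z. x \<in> topspace X \<Longrightarrow> z \<in> topspace X \<Longrightarrow> (x, z) \<in> r \<longleftrightarrow> (e x, e z) \<in> s"
    by (auto simp: pospace_embedding_def)
  have cont: "continuous_map X Y e"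
    using emb unfolding embedding_map_def homeomorphic_eq_everything_map continuous_map_in_subtopology
    by blast
  then have im: "e ` topspace X \<subseteq> topspace Y"
    by (simp add: continuous_map_image_subset_topspace)
  have cptL: "compactin Y (e ` L)"
    using assms(2,3) cont
    by (metis compact_pospace_def compactin_subspace image_compactin)
  have "y \<in> e ` topspace X" if y: "y \<in> Y closure_of (e ` topspace X)" for y
  proof (rule ccontr)
    assume notin: "y \<notin> e ` topspace X"
    have yY: "compactin Y {y}"
      using y in_closure_of by fastforce
    define A where "A = {x \<in> L. (e x, y) \<in> s}"
    define B where "B = {x \<in> L. (y, e x) \<in> s}"
    define G where "G = topspace X - r\<inverse> `` A - r `` B"
    have "(e x, e z) \<in> s \<or> (e z, e x) \<in> s" if "x \<in> topspace X" "z \<in> topspace X" for x z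
      using linear_order_on_comparable[OF lin that] that mono by blast
    then have comparable: "(x, y) \<in> s \<or> (y, x) \<in> s" if "x \<in> e ` topspace X" for x
      using comparable_to_closure_of_chain[OF Y im _ y that] by blast
    have L: "L = A \<union> B"
      using comparable assms(2) unfolding A_def B_def by blast
    have "e ` A = e ` L \<inter> s\<inverse> `` {y}" "e ` B = e ` L \<inter> s `` {y}"
      unfolding A_def B_def by auto
    then have "compactin Y (e ` A)" "compactin Y (e ` B)"
      using cptL Y yY
      by (simp_all add: compact_Int_closedin closedin_upset_of_compact
          closedin_downset_of_compact)
    then have closedAB: "closedin Y (s\<inverse> `` (e ` A))" "closedin Y (s `` (e ` B))"
      using Y closedin_downset_of_compact closedin_upset_of_compact by blast+
    have "compactin Y (e ` G)"
    proof (cases "G = {}")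
      case False
      then have "maximal_subset_chain r (topspace X - L) G"
        using gap_is_maximal_subset_chain[OF lin rX, of A B] assms(2) L
        unfolding G_def by simp
      then have "compact_space (subtopology X G)"
        using assms(4) by (simp add: compact_pospace_def)
      then have "compactin X G"
        unfolding G_def by (simp add: compactin_subspace Diff_subset le_infI1 subset_iff)
      then show ?thesis
        using cont image_compactin by blast
    qed simp
    then have closedG: "closedin Y (e ` G)"
      using Y compactin_imp_closedin unfolding pospace_def by blast
    have cover: "e ` topspace X \<subseteq> s\<inverse> `` (e ` A) \<union> s `` (e ` B) \<union> e ` G"
    proof (rule image_subsetI)
      fix x
      assume x: "x \<in> topspace X"
      then consider "x \<in> G" | a where "a \<in> A" "(x, a) \<in> r" | b where "b \<in> B" "(b, x) \<in> r"
        unfolding G_def by blast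
      then show "e x \<in> s\<inverse> `` (e ` A) \<union> s `` (e ` B) \<union> e ` G"
      proof cases
        case 2
        then have "(e x, e a) \<in> s"
          using rX mono by blast
        then show ?thesis
          using 2 by blast
      next
        case 3
        then have "(e b, e x) \<in> s"
          using rX mono by blast
        then show ?thesis
          using 3 by blast
      qed simp
    qed
    have "y \<in> s\<inverse> `` (e ` A) \<union> s `` (e ` B) \<union> e ` G"
      using closure_of_minimal[OF cover] closedAB closedG y by (meson closedin_Un subsetD)
    moreover have "y \<notin> e ` G"
      using notin unfolding G_def by blast
    \<comment> \<open>By antisymmetry, a point of \<open>e ` L\<close> on both sides of \<open>y\<close> would be \<open>y\<close> itself.\<close>
    ultimately obtain x where "x \<in> L" "(y, e x) \<in> s" "(e x, y) \<in> s"
      unfolding A_def B_def by blast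
    then have "y = e x"
      using Y unfolding pospace_def order_on_defs by (blast dest: antisymD)
    with \<open>x \<in> L\<close> notin assms(2) show False
      by blast
  qed
  then show "closedin Y (e ` topspace X)"
    using im closure_of_subset_eq by blast
qed

end
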